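(* Let $K$ be an algebraically closed field of characteristic $0$, let $s\geq 2$, and let $I\subset K[\mathbf{P}^2]$ be the radical ideal of the $\binom{s}{2}$ points of pairwise intersection of $s$ distinct lines in $\mathbf{P}^2$, no three of which meet at a point. Let $M\subset K[\mathbf{P}^2]$ be the ideal generated by the variables. Then for all integers $m,t,r\geq 1$: (i) $I^{(t(m+1))}\subseteq M^{t}(I^{(m)})^t$; (ii) $\dfrac{\alpha(I^{(m)})+1}{m+1}\leq\dfrac{\alpha(I^{(r)})}{r}$; (iii) $I^{(t(m+1)-1)}\subseteq M^{t-1}(I^{(m)})^t$ (and hence $I^{(t(m+1)-1)}\subseteq (I^{(m)})^t$).
   Context: For a nonzero homogeneous ideal $J$, $\alpha(J)$ is the least degree of a nonzero form in $J$. For distinct points $P_1,\ldots,P_n\in\mathbf{P}^2$ with radical ideal $I=\bigcap_i I(P_i)$, where $I(P_i)$ is the ideal generated by all forms vanishing at $P_i$, the $m$-th symbolic power is $I^{(m)}=\bigcap_i I(P_i)^m$. For any ideal $J$, $J^0$ is the whole ring. *)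

theory Defs
  imports
    "HOL-Analysis.Cartesian_Space"
    "HOL-Library.Poly_Mapping"
    "HOL-Library.Numeral_Type"
    "HOL-Computational_Algebra.Polynomial"
begin

section \<open>The homogeneous coordinate ring of the projective plane\<close>

text \<open>An element of \<open>K[x\<^sub>0, x\<^sub>1, x\<^sub>2]\<close> maps each exponent vector to its coefficient; multiplication is
  the convolution product of \<^theory>\<open>HOL-Library.Poly_Mapping\<close>.\<close>

type_synonym 'k poly3 = "(3 \<Rightarrow>\<^sub>0 nat) \<Rightarrow>\<^sub>0 'k"

definition variable :: "3 \<Rightarrow> 'k::comm_ring_1 poly3" where
  "variable i = Poly_Mapping.single (Poly_Mapping.single i 1) 1"

definition eval3 :: "'k::comm_ring_1 poly3 \<Rightarrow> 'k ^ 3 \<Rightarrow> 'k" where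
  "eval3 F v = (\<Sum>e\<in>Poly_Mapping.keys F.
     Poly_Mapping.lookup F e * (\<Prod>i\<in>UNIV. (v $ i) ^ Poly_Mapping.lookup e i))"

text \<open>As usual, the zero polynomial is a form of every degree.\<close>

definition form :: "nat \<Rightarrow> 'k::zero poly3 \<Rightarrow> bool" where
  "form d F \<longleftrightarrow> (\<forall>e\<in>Poly_Mapping.keys F. (\<Sum>i\<in>UNIV. Poly_Mapping.lookup e i) = d)"


section \<open>Ideals\<close>

text \<open>The ideal generated by a set is its span in the ring, viewed as a module over itself.\<close>

definition ideal_gen :: "'r::comm_ring_1 set \<Rightarrow> 'r set" where
  "ideal_gen S = module.span (*) S"

definition ideal_mult :: "'r::comm_ring_1 set \<Rightarrow> 'r set \<Rightarrow> 'r set" where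
  "ideal_mult A B = ideal_gen {a * b | a b. a \<in> A \<and> b \<in> B}"

primrec ideal_pow :: "'r::comm_ring_1 set \<Rightarrow> nat \<Rightarrow> 'r set" where
  "ideal_pow J 0 = UNIV"
| "ideal_pow J (Suc n) = ideal_mult J (ideal_pow J n)"

definition irrelevant_ideal :: "'k::comm_ring_1 poly3 set" where
  "irrelevant_ideal = ideal_gen (range variable)"

text \<open>Only meaningful if \<open>J\<close> contains a nonzero form.\<close>

definition alpha :: "'k::zero poly3 set \<Rightarrow> nat" where
  "alpha J = (LEAST d. \<exists>F\<in>J. F \<noteq> 0 \<and> form d F)"


section \<open>Points and lines of the projective plane\<close>

text \<open>A point is the set of all its homogeneous coordinate vectors.\<close>

definition proj_rel :: "(('k::field ^ 3) \<times> ('k ^ 3)) set" where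
  "proj_rel = {(v, w). v \<noteq> 0 \<and> w \<noteq> 0 \<and> (\<exists>c. c \<noteq> 0 \<and> w = c *s v)}"

definition proj_plane :: "('k::field ^ 3) set set" where
  "proj_plane = (UNIV - {0}) // proj_rel"

definition vanishes_at :: "'k::field poly3 \<Rightarrow> ('k ^ 3) set \<Rightarrow> bool" where
  "vanishes_at F P \<longleftrightarrow> (\<forall>v\<in>P. eval3 F v = 0)"

definition proj_line :: "('k::field ^ 3) set set \<Rightarrow> bool" where
  "proj_line L \<longleftrightarrow> (\<exists>F. F \<noteq> 0 \<and> form 1 F \<and> L = {P \<in> proj_plane. vanishes_at F P})"

definition intersection_points :: "('k::field ^ 3) set set set \<Rightarrow> ('k ^ 3) set set" where
  "intersection_points \<L> = {P. \<exists>L\<in>\<L>. \<exists>L'\<in>\<L>. L \<noteq> L' \<and> P \<in> L \<inter> L'}"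


section \<open>Ideals of points and their symbolic powers\<close>

definition point_ideal :: "('k::field ^ 3) set \<Rightarrow> 'k poly3 set" where
  "point_ideal P = ideal_gen {F. (\<exists>d. form d F) \<and> vanishes_at F P}"

text \<open>The symbolic power \<open>I\<^sup>(\<^sup>m\<^sup>)\<close> of the radical ideal \<open>I = (\<Inter>P\<in>Z. point_ideal P)\<close> of a finite
  nonempty set \<open>Z\<close> of points.  It is a function of \<open>Z\<close>, which determines and is determined by \<open>I\<close>.\<close>

definition symbolic_power :: "('k::field ^ 3) set set \<Rightarrow> nat \<Rightarrow> 'k poly3 set" where
  "symbolic_power Z m = (\<Inter>P\<in>Z. ideal_pow (point_ideal P) m)"

end

(*
Let l_1, ..., l_s be linear forms cutting out the lines, so that the point of intersection of two of
the lines has the ideal (l_i, l_j).  The symbolic powers of I are generated by monomials in the l_i: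

  I^(m) is generated by the products prod l_i^(a_i) with a_i + a_j >= m for all i < j.

For the proof one describes, more generally, the polynomials F such that prod l_i^(b_i) F lies in
I^(m).  If 2 b_i < m, then F restricted to the i-th line is divisible by the product P of the
l_j^(m - b_i - b_j), j <> i, since those restrictions are pairwise non-associate primes.  Hence
F = P H + l_i G, where P already is of the required shape because 2 b_i < m, and one continues with G
and b_i + 1.  Once 2 b_i >= m for all i there is no condition left on F.

Now (i) and (iii) reduce to exponent vectors.  Only the least exponent p and a common lower bound q
of the others matter, and (p, q) is split into balanced pairs with sum m + 1, from each of which one
linear form can be removed.  For (ii), apply (i) with t = r to F^(m+1), where F is a form of least
degree in I^(r), and compare degrees.
*)
theory Submission
  imports Defs
begin

section \<open>Ideals generated by two elements\<close>

text \<open>The submodules of a ring, viewed as a module over itself, are its ideals; the closure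
  rules for submodules and spans thus become rules for ideals.\<close>

interpretation ideal: module "(*) :: 'r::comm_ring_1 \<Rightarrow> 'r \<Rightarrow> 'r"
  by unfold_locales (simp_all add: algebra_simps)

text \<open>As a rewrite rule, this would loop with associativity.\<close>
declare ideal.scale_scale [simp del]

abbreviation is_ideal :: "'r::comm_ring_1 set \<Rightarrow> bool" where
  "is_ideal \<equiv> module.subspace (*)"

lemma is_ideal_ideal_gen [simp]: "is_ideal (ideal_gen S)"
  unfolding ideal_gen_def by simp

lemma is_ideal_ideal_mult [simp]: "is_ideal (ideal_mult A B)"
  unfolding ideal_mult_def by simp

lemma is_ideal_ideal_pow [simp]: "is_ideal (ideal_pow J n)"
  by (cases n) (simp_all add: ideal.subspace_UNIV)

lemma ideal_gen_subset: "S \<subseteq> J \<Longrightarrow> is_ideal J \<Longrightarrow> ideal_gen S \<subseteq> J"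
  unfolding ideal_gen_def by (rule ideal.span_minimal)

lemma ideal_gen_base: "a \<in> S \<Longrightarrow> a \<in> ideal_gen S"
  unfolding ideal_gen_def by (rule ideal.span_base)

lemma ideal_mult_memI: "a \<in> A \<Longrightarrow> b \<in> B \<Longrightarrow> a * b \<in> ideal_mult A B"
  unfolding ideal_mult_def by (rule ideal_gen_base) blast

lemma ideal_mult_subset:
  assumes "\<And>a b. a \<in> A \<Longrightarrow> b \<in> B \<Longrightarrow> a * b \<in> J" "is_ideal J"
  shows "ideal_mult A B \<subseteq> J"
  unfolding ideal_mult_def using assms by (intro ideal_gen_subset) auto

lemma ideal_mult_subset_right: "is_ideal B \<Longrightarrow> ideal_mult A B \<subseteq> B"
  by (rule ideal_mult_subset) (rule ideal.subspace_scale)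

text \<open>The elements that \<open>c\<close> multiplies into \<open>J\<close> form an ideal, so
  testing generators is enough.\<close>

lemma ideal_gen_mult_left:
  assumes "F \<in> ideal_gen S" "is_ideal J" "\<And>s. s \<in> S \<Longrightarrow> c * s \<in> J"
  shows "c * F \<in> J"
proof -
  have "is_ideal {F. c * F \<in> J}"
  proof (intro ideal.subspaceI CollectI)
    show "c * 0 \<in> J" using ideal.subspace_0[OF assms(2)] by simp
  next
    fix F G assume "F \<in> {F. c * F \<in> J}" "G \<in> {F. c * F \<in> J}"
    then show "c * (F + G) \<in> J"
      using ideal.subspace_add[OF assms(2)] by (simp add: distrib_left)
  next
    fix d F assume "F \<in> {F. c * F \<in> J}"
    then have "d * (c * F) \<in> J" using ideal.subspace_scale[OF assms(2)] by blast
    then show "c * (d * F) \<in> J" by (metis mult.left_commute)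
  qed
  then have "ideal_gen S \<subseteq> {F. c * F \<in> J}"
    using assms(3) by (intro ideal_gen_subset) auto
  then show ?thesis using assms(1) by auto
qed

lemma ideal_mult_mult_left:
  assumes "a \<in> ideal_mult A B" "is_ideal J" "\<And>x y. x \<in> A \<Longrightarrow> y \<in> B \<Longrightarrow> c * (x * y) \<in> J"
  shows "c * a \<in> J"
proof (rule ideal_gen_mult_left)
  show "a \<in> ideal_gen {a * b |a b. a \<in> A \<and> b \<in> B}"
    using assms(1) by (simp add: ideal_mult_def)
qed (use assms in auto)

lemma ideal_pow_add:
  assumes "a \<in> ideal_pow J m" "b \<in> ideal_pow J n"
  shows "a * b \<in> ideal_pow J (m + n)"
  using assms(1)
proof (induction m arbitrary: a)
  case 0
  then show ?case using assms(2) by (simp add: ideal.subspace_scale)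
next
  case (Suc m)
  have "b * a \<in> ideal_pow J (Suc m + n)"
  proof (rule ideal_mult_mult_left)
    fix x y assume "x \<in> J" "y \<in> ideal_pow J m"
    then have "x * (y * b) \<in> ideal_pow J (Suc m + n)"
      unfolding add_Suc ideal_pow.simps by (intro ideal_mult_memI Suc.IH)
    then show "b * (x * y) \<in> ideal_pow J (Suc m + n)" by (simp add: ac_simps)
  qed (use Suc.prems in simp_all)
  then show ?case by (simp add: mult.commute)
qed

lemma ideal_pow_power:
  "a \<in> ideal_pow J m \<Longrightarrow> a ^ n \<in> ideal_pow J (m * n)"
  by (induction n) (auto intro: ideal_pow_add)

lemma power_mem_ideal_pow: "a \<in> J \<Longrightarrow> a ^ n \<in> ideal_pow J n"
  by (induction n) (auto intro: ideal_mult_memI)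

lemma ideal_pow_Suc_subset: "ideal_pow J (Suc n) \<subseteq> ideal_pow J n"
  by (simp add: ideal_mult_subset_right)

lemma ideal_pow_antimono: "k \<le> n \<Longrightarrow> ideal_pow J n \<subseteq> ideal_pow J k"
  by (induction n rule: dec_induct) (use ideal_pow_Suc_subset in blast)+

section \<open>Powers of an ideal with two generators\<close>

lemma ideal_gen_pair: "F \<in> ideal_gen {x, y} \<longleftrightarrow> (\<exists>a b. F = x * a + y * b)"
proof -
  have "F \<in> ideal_gen {x, y} \<longleftrightarrow> (\<exists>a b. F - a * x - b * y = 0)"
    unfolding ideal_gen_def ideal.span_breakdown_eq ideal.span_empty by simp
  then show ?thesis by (simp add: algebra_simps)
qed

text \<open>The elements of the shape on the right form an ideal, and every product of an element of
  \<open>ideal_gen {x, y}\<close> with one of its \<open>n\<close>-th power has this shape.\<close>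

lemma ideal_pow_pair_Suc:
  "F \<in> ideal_pow (ideal_gen {x, y}) (Suc n) \<longleftrightarrow>
     (\<exists>A B. A \<in> ideal_pow (ideal_gen {x, y}) n \<and> B \<in> ideal_pow (ideal_gen {x, y}) n \<and>
        F = x * A + y * B)"
proof
  let ?J = "ideal_gen {x, y}"
  have sub: "is_ideal (ideal_pow ?J n)" by simp
  have "is_ideal {F. \<exists>A B. A \<in> ideal_pow ?J n \<and> B \<in> ideal_pow ?J n \<and> F = x * A + y * B}" (is "is_ideal ?T")
    unfolding ideal.subspace_def
  proof (intro conjI ballI allI)
    show "0 \<in> ?T"
      using ideal.subspace_0[OF sub] by (auto intro!: exI[of _ 0])
  next
    fix F G assume "F \<in> ?T" "G \<in> ?T"
    then obtain A B C D where "A \<in> ideal_pow ?J n" "B \<in> ideal_pow ?J n" "F = x * A + y * B"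
      "C \<in> ideal_pow ?J n" "D \<in> ideal_pow ?J n" "G = x * C + y * D" by auto
    moreover from this have "F + G = x * (A + C) + y * (B + D)" by (simp add: algebra_simps)
    ultimately show "F + G \<in> ?T"
      using ideal.subspace_add[OF sub] by blast
  next
    fix c F assume "F \<in> ?T"
    then obtain A B where "A \<in> ideal_pow ?J n" "B \<in> ideal_pow ?J n" "F = x * A + y * B" by auto
    moreover from this have "c * F = x * (c * A) + y * (c * B)" by (simp add: algebra_simps)
    ultimately show "c * F \<in> ?T"
      using ideal.subspace_scale[OF sub] by blast
  qed
  moreover have "u * b \<in> ?T" if u: "u \<in> ?J" and b: "b \<in> ideal_pow ?J n" for u b
  proof -
    obtain p q where "u = x * p + y * q" using u unfolding ideal_gen_pair by blast
    then have "u * b = x * (p * b) + y * (q * b)" by (simp add: algebra_simps)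
    then show ?thesis
      using ideal.subspace_scale[OF sub b] by blast
  qed
  ultimately have "ideal_pow ?J (Suc n) \<subseteq> ?T"
    unfolding ideal_pow.simps by (intro ideal_mult_subset)
  moreover assume "F \<in> ideal_pow ?J (Suc n)"
  ultimately show "\<exists>A B. A \<in> ideal_pow ?J n \<and> B \<in> ideal_pow ?J n \<and> F = x * A + y * B"
    by auto
next
  let ?J = "ideal_gen {x, y}"
  assume "\<exists>A B. A \<in> ideal_pow ?J n \<and> B \<in> ideal_pow ?J n \<and> F = x * A + y * B"
  moreover have "x \<in> ?J" "y \<in> ?J" by (auto intro: ideal_gen_base)
  ultimately show "F \<in> ideal_pow ?J (Suc n)"
    by (auto simp del: is_ideal_ideal_mult intro!: ideal.subspace_add[OF is_ideal_ideal_mult] ideal_mult_memI)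
qed

text \<open>Among the monomials of degree \<open>n + 1\<close> in \<open>x\<close> and
  \<open>y\<close>, only \<open>y ^ Suc n\<close> lacks the factor \<open>x\<close>. This normal
  form lets \<open>x\<close> be divided out in inductions on the exponent.\<close>

lemma ideal_pow_pair_Suc':
  "F \<in> ideal_pow (ideal_gen {x, y}) (Suc n) \<longleftrightarrow>
     (\<exists>A c. A \<in> ideal_pow (ideal_gen {x, y}) n \<and> F = x * A + y ^ Suc n * c)"
proof
  let ?J = "ideal_gen {x, y}"
  have xy: "x \<in> ?J" "y \<in> ?J" by (auto intro: ideal_gen_base)
  show "F \<in> ideal_pow ?J (Suc n) \<Longrightarrow> \<exists>A c. A \<in> ideal_pow ?J n \<and> F = x * A + y ^ Suc n * c"
  proof (induction n arbitrary: F)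
    case 0
    then show ?case using ideal_pow_pair_Suc[of F x y 0] by simp
  next
    case (Suc n)
    then obtain A B where AB: "A \<in> ideal_pow ?J (Suc n)" "B \<in> ideal_pow ?J (Suc n)" "F = x * A + y * B"
      using ideal_pow_pair_Suc by blast
    then obtain B' c where B': "B' \<in> ideal_pow ?J n" "B = x * B' + y ^ Suc n * c"
      using Suc.IH by blast
    have "A + y * B' \<in> ideal_pow ?J (Suc n)"
      using AB(1) B'(1) xy by (auto intro!: ideal.subspace_add[OF is_ideal_ideal_mult] ideal_mult_memI)
    moreover have "F = x * (A + y * B') + y ^ Suc (Suc n) * c"
      unfolding AB(3) B'(2) by (simp add: algebra_simps)
    ultimately show ?case by blast
  qed
  show "F \<in> ideal_pow ?J (Suc n)" if ex: "\<exists>A c. A \<in> ideal_pow ?J n \<and> F = x * A + y ^ Suc n * c"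
  proof -
    obtain A c where A: "A \<in> ideal_pow ?J n" "F = x * A + y ^ Suc n * c" using ex by blast
    have "x * A \<in> ideal_pow ?J (Suc n)" using A xy by (auto intro: ideal_mult_memI)
    moreover have "c * y ^ Suc n \<in> ideal_pow ?J (Suc n)"
      by (intro ideal.subspace_scale is_ideal_ideal_pow power_mem_ideal_pow xy)
    ultimately show ?thesis
      using ideal.subspace_add[OF is_ideal_ideal_pow] A(2) by (metis mult.commute)
  qed
qed

section \<open>Colon ideals along a regular sequence\<close>

text \<open>In other words, \<open>z\<close> is a nonzerodivisor modulo the ideal generated by
  \<open>x\<close> and \<open>y\<close>.\<close>

definition cancels :: "'r::comm_ring_1 \<Rightarrow> 'r \<Rightarrow> 'r \<Rightarrow> bool" where
  "cancels x y z \<longleftrightarrow> (\<forall>G. z * G \<in> ideal_gen {x, y} \<longrightarrow> G \<in> ideal_gen {x, y})"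

lemma dvd_power_cancel:
  fixes x y :: "'r::comm_ring_1"
  assumes "\<And>G. x dvd y * G \<Longrightarrow> x dvd G" "x dvd y ^ n * G"
  shows "x dvd G"
  using assms(2)
proof (induction n)
  case (Suc n)
  then have "x dvd y * (y ^ n * G)" by (simp add: mult.assoc)
  then show ?case by (rule Suc.IH[OF assms(1)])
qed simp

lemma cancels_one [simp]: "cancels x y 1"
  by (simp add: cancels_def)

lemma cancels_mult: "cancels x y u \<Longrightarrow> cancels x y v \<Longrightarrow> cancels x y (u * v)"
  unfolding cancels_def mult.assoc by blast

lemma cancels_power: "cancels x y z \<Longrightarrow> cancels x y (z ^ n)"
  by (induction n) (auto intro: cancels_mult)

lemma cancels_prod: "(\<And>j. j \<in> A \<Longrightarrow> cancels x y (f j)) \<Longrightarrow> cancels x y (\<Prod>j\<in>A. f j)"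
  by (induction A rule: infinite_finite_induct) (auto intro: cancels_mult)

text \<open>Induction on \<open>n\<close>: cancelling \<open>z\<close> modulo \<open>x\<close> and
  \<open>y\<close> gives \<open>G = x * d + y * G'\<close>. Since \<open>y\<close> cancels modulo
  \<open>x\<close>, the cofactor \<open>G'\<close> satisfies the same hypothesis with one power of
  \<open>y\<close> less.\<close>

lemma cancels_power_right:
  assumes z: "cancels x y z" and y: "\<And>G. x dvd y * G \<Longrightarrow> x dvd G"
  shows "cancels x (y ^ n) z"
proof -
  have "G \<in> ideal_gen {x, y ^ n}" if "z * G \<in> ideal_gen {x, y ^ n}" for G
    using that
  proof (induction n arbitrary: G)
    case 0
    have "G = x * 0 + y ^ 0 * G" by simp
    then show ?case unfolding ideal_gen_pair by blast
  next
    case (Suc n)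
    then obtain a c where ac: "z * G = x * a + y ^ Suc n * c" unfolding ideal_gen_pair by blast
    then have "z * G = x * a + y * (y ^ n * c)" by (simp add: mult.assoc)
    then have "z * G \<in> ideal_gen {x, y}" unfolding ideal_gen_pair by blast
    then have "G \<in> ideal_gen {x, y}" using z unfolding cancels_def by blast
    then obtain d G' where G: "G = x * d + y * G'" unfolding ideal_gen_pair by blast
    have "y * (z * G' - y ^ n * c) = x * (a - z * d)"
      using ac unfolding G by (simp add: algebra_simps)
    then have "x dvd z * G' - y ^ n * c" using y by (metis dvd_triv_left)
    then obtain e where "z * G' = x * e + y ^ n * c" by (auto simp: dvd_def algebra_simps)
    then have "z * G' \<in> ideal_gen {x, y ^ n}" unfolding ideal_gen_pair by blast
    then have "G' \<in> ideal_gen {x, y ^ n}" by (rule Suc.IH)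
    then obtain p q where "G' = x * p + y ^ n * q" unfolding ideal_gen_pair by blast
    then have "G = x * (d + y * p) + y ^ Suc n * q" unfolding G by (simp add: algebra_simps)
    then show ?case unfolding ideal_gen_pair by blast
  qed
  then show ?thesis unfolding cancels_def by blast
qed

text \<open>In the normal form of \<open>x * G\<close>, the coefficient of the pure power of
  \<open>y\<close> is divisible by \<open>x\<close>, because \<open>y\<close> cancels modulo
  \<open>x\<close>; then \<open>x\<close> cancels in the domain. For \<open>n = 0\<close> both
  powers are the whole ring, by truncated subtraction.\<close>

lemma ideal_pow_pair_cancel_generator:
  fixes x y :: "'r::idom"
  assumes y: "\<And>G. x dvd y * G \<Longrightarrow> x dvd G" and "x \<noteq> 0"
    and G: "x * G \<in> ideal_pow (ideal_gen {x, y}) n"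
  shows "G \<in> ideal_pow (ideal_gen {x, y}) (n - 1)"
proof (cases n)
  case (Suc k)
  note pow = dvd_power_cancel[where x = x, OF y]
  obtain A c where A: "A \<in> ideal_pow (ideal_gen {x, y}) k" "x * G = x * A + y ^ Suc k * c"
    using G unfolding Suc ideal_pow_pair_Suc' by blast
  then have "y ^ Suc k * c = x * (G - A)" by (simp add: algebra_simps)
  then have "x dvd c" using pow by (metis dvd_triv_left)
  then obtain c' where c: "c = x * c'" by (auto simp: dvd_def)
  have "x * G = x * (A + y * c' * y ^ k)"
    using A(2) unfolding c by (simp add: algebra_simps)
  then have "G = A + y * c' * y ^ k" using \<open>x \<noteq> 0\<close> by simp
  moreover have "y \<in> ideal_gen {x, y}" by (simp add: ideal_gen_base)
  ultimately show ?thesis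
    using A(1) Suc by (simp add: ideal.subspace_add ideal.subspace_scale power_mem_ideal_pow)
qed simp

text \<open>A nonzerodivisor modulo \<open>x\<close> and \<open>y\<close> remains one modulo the
  powers of the ideal: the normal form reduces exponent \<open>n + 1\<close> to exponent
  \<open>n\<close>.\<close>

lemma ideal_pow_pair_cancel:
  fixes x y :: "'r::idom"
  assumes y: "\<And>G. x dvd y * G \<Longrightarrow> x dvd G" and "x \<noteq> 0" and z: "cancels x y z"
    and "z * G \<in> ideal_pow (ideal_gen {x, y}) n"
  shows "G \<in> ideal_pow (ideal_gen {x, y}) n"
  using assms(4)
proof (induction n arbitrary: G)
  case (Suc n)
  note pow = dvd_power_cancel[where x = x, OF y]
  obtain A c where A: "A \<in> ideal_pow (ideal_gen {x, y}) n" "z * G = x * A + y ^ Suc n * c"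
    using Suc.prems unfolding ideal_pow_pair_Suc' by blast
  then have "z * G \<in> ideal_gen {x, y ^ Suc n}" unfolding ideal_gen_pair by blast
  then have "G \<in> ideal_gen {x, y ^ Suc n}"
    using cancels_power_right[OF z y] unfolding cancels_def by blast
  \<comment> \<open>The summand with \<open>y ^ Suc n\<close> already lies in the power, so it
    remains to place \<open>G'\<close> in the \<open>n\<close>-th power; for this
    \<open>z * G'\<close> is computed modulo that power.\<close>
  then obtain G' d where G: "G = x * G' + y ^ Suc n * d" unfolding ideal_gen_pair by blast
  have eq: "x * (z * G' - A) = y ^ Suc n * (c - z * d)"
    using A(2) unfolding G by (simp add: algebra_simps)
  then have "x dvd c - z * d" using pow by (metis dvd_triv_left)
  then obtain e where e: "c - z * d = x * e" by (auto simp: dvd_def)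
  have "x * (z * G' - A) = x * (y ^ Suc n * e)"
    using eq unfolding e by (simp add: algebra_simps)
  then have "z * G' - A = y ^ Suc n * e" using \<open>x \<noteq> 0\<close> by simp
  then have "z * G' = A + y * e * y ^ n" by (simp add: algebra_simps)
  moreover have "y \<in> ideal_gen {x, y}" by (simp add: ideal_gen_base)
  ultimately have "z * G' \<in> ideal_pow (ideal_gen {x, y}) n"
    using A(1) by (simp add: ideal.subspace_add ideal.subspace_scale power_mem_ideal_pow)
  then have "G' \<in> ideal_pow (ideal_gen {x, y}) n" by (rule Suc.IH)
  then show ?case using G unfolding ideal_pow_pair_Suc' by blast
qed simp

section \<open>Symbolic powers of star configurations\<close>

text \<open>Used to peel off factors one at a time: each contributes an element \<open>x\<close> of
  \<open>M\<close> and an element \<open>y\<close> of \<open>S\<close>.\<close>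

lemma ideal_mult_pow_Suc:
  assumes "x \<in> M" "y \<in> S" "z \<in> ideal_mult (ideal_pow M t) (ideal_pow S n)"
  shows "x * y * z \<in> ideal_mult (ideal_pow M (Suc t)) (ideal_pow S (Suc n))"
proof (rule ideal_mult_mult_left[OF assms(3) is_ideal_ideal_mult])
  fix u v assume "u \<in> ideal_pow M t" "v \<in> ideal_pow S n"
  then have "(x * u) * (y * v) \<in> ideal_mult (ideal_pow M (Suc t)) (ideal_pow S (Suc n))"
    using assms(1,2) unfolding ideal_pow.simps by (intro ideal_mult_memI)
  then show "x * y * (u * v) \<in> ideal_mult (ideal_pow M (Suc t)) (ideal_pow S (Suc n))"
    by (simp only: ac_simps)
qed

lemma ideal_pow_pair_subset: "ideal_pow (ideal_gen {x, y}) n \<subseteq> ideal_gen {x, y ^ n}"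
proof (cases n)
  case 0
  have "F = x * 0 + y ^ 0 * F" for F by simp
  then show ?thesis using 0 unfolding subset_iff ideal_gen_pair by blast
next
  case (Suc k)
  show ?thesis
  proof
    fix F assume "F \<in> ideal_pow (ideal_gen {x, y}) n"
    then obtain A c where "F = x * A + y ^ n * c"
      unfolding Suc ideal_pow_pair_Suc' by blast
    then show "F \<in> ideal_gen {x, y ^ n}" unfolding ideal_gen_pair by blast
  qed
qed

text \<open>All that the algebra needs to know about the lines: each form is a nonzerodivisor modulo
  any other, and a third form is a nonzerodivisor modulo any two.\<close>

locale star_configuration =
  fixes I :: "'i set" and l :: "'i \<Rightarrow> 'r::idom"
  assumes finite_I: "finite I"
    and nonzero: "i \<in> I \<Longrightarrow> l i \<noteq> 0"
    and dvd_cancel: "i \<in> I \<Longrightarrow> j \<in> I \<Longrightarrow> i \<noteq> j \<Longrightarrow> l i dvd l j * G \<Longrightarrow> l i dvd G"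
    and triple_cancel: "i \<in> I \<Longrightarrow> j \<in> I \<Longrightarrow> k \<in> I \<Longrightarrow> i \<noteq> j \<Longrightarrow> i \<noteq> k \<Longrightarrow> j \<noteq> k
      \<Longrightarrow> cancels (l i) (l j) (l k)"
begin

definition mon :: "('i \<Rightarrow> nat) \<Rightarrow> 'r" where
  "mon a = (\<Prod>i\<in>I. l i ^ a i)"

text \<open>Two lines meet in the point with ideal \<open>ideal_gen {l i, l j}\<close>, so for lines
  in general position this is the symbolic power, expressed without points.\<close>

definition sym_pow :: "nat \<Rightarrow> 'r set" where
  "sym_pow m = (\<Inter>i\<in>I. \<Inter>j\<in>I - {i}. ideal_pow (ideal_gen {l i, l j}) m)"

lemma mon_add: "mon (\<lambda>i. a i + b i) = mon a * mon b"
  by (simp add: mon_def power_add prod.distrib)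

lemma mon_upd: "i \<in> I \<Longrightarrow> mon (a(i := Suc (a i))) = l i * mon a"
  unfolding mon_def by (simp add: prod.remove[OF finite_I, of i] mult.assoc)

lemma mon_nonzero: "mon a \<noteq> 0"
  using nonzero by (simp add: mon_def finite_I)

lemma mon_mem_ideal_pow:
  assumes "i \<in> I" "j \<in> I" "i \<noteq> j" "n \<le> a i + a j"
  shows "mon a \<in> ideal_pow (ideal_gen {l i, l j}) n"
proof -
  let ?J = "ideal_gen {l i, l j}"
  have "mon a = (l i ^ a i * l j ^ a j) * (\<Prod>k\<in>I - {i} - {j}. l k ^ a k)"
    unfolding mon_def using assms finite_I
    by (simp add: prod.remove[of I i] prod.remove[of "I - {i}" j] mult.assoc)
  moreover have "l i \<in> ?J" "l j \<in> ?J" by (simp_all add: ideal_gen_base)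
  then have "l i ^ a i * l j ^ a j \<in> ideal_pow ?J (a i + a j)"
    by (intro ideal_pow_add power_mem_ideal_pow)
  then have "l i ^ a i * l j ^ a j \<in> ideal_pow ?J n"
    using ideal_pow_antimono[OF assms(4)] by blast
  ultimately show ?thesis
    by (metis ideal.subspace_scale is_ideal_ideal_pow mult.commute)
qed

lemma is_ideal_sym_pow [simp]: "is_ideal (sym_pow m)"
  unfolding sym_pow_def
  by (intro ideal.subspaceI INT_I)
    (blast intro: ideal.subspace_0[OF is_ideal_ideal_pow] ideal.subspace_add[OF is_ideal_ideal_pow]
      ideal.subspace_scale[OF is_ideal_ideal_pow])+

lemma mon_mem_sym_pow:
  assumes "\<And>i j. i \<in> I \<Longrightarrow> j \<in> I \<Longrightarrow> i \<noteq> j \<Longrightarrow> m \<le> a i + a j"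
  shows "mon a \<in> sym_pow m"
  unfolding sym_pow_def using assms by (auto intro!: mon_mem_ideal_pow)

lemma sym_pow_power: "F \<in> sym_pow m \<Longrightarrow> F ^ n \<in> sym_pow (m * n)"
  unfolding sym_pow_def by (auto intro: ideal_pow_power)

text \<open>Modulo \<open>l i\<close>, divisibility by each of the powers \<open>l j ^ n j\<close>
  implies divisibility by their product. In the induction, the product over \<open>J\<close> cancels
  modulo \<open>l i\<close> and the new power \<open>l k ^ n k\<close>.\<close>

lemma mem_ideal_gen_prod:
  assumes "finite J" "J \<subseteq> I - {i}" "i \<in> I"
    and "\<And>j. j \<in> J \<Longrightarrow> F \<in> ideal_pow (ideal_gen {l i, l j}) (n j)"
  shows "F \<in> ideal_gen {l i, \<Prod>j\<in>J. l j ^ n j}"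
  using assms
proof (induction J)
  case empty
  have "F = l i * 0 + (\<Prod>j\<in>{}. l j ^ n j) * F" by simp
  then show ?case unfolding ideal_gen_pair by blast
next
  case (insert k J)
  let ?P = "\<Prod>j\<in>J. l j ^ n j"
  have "F \<in> ideal_gen {l i, ?P}" using insert by auto
  then obtain a H where F: "F = l i * a + ?P * H" unfolding ideal_gen_pair by blast
  have "F \<in> ideal_gen {l i, l k ^ n k}" using insert.prems ideal_pow_pair_subset by blast
  then obtain p q where "F = l i * p + l k ^ n k * q" unfolding ideal_gen_pair by blast
  then have "?P * H = l i * (p - a) + l k ^ n k * q" using F by (simp add: algebra_simps)
  then have "?P * H \<in> ideal_gen {l i, l k ^ n k}" unfolding ideal_gen_pair by blast
  moreover have "cancels (l i) (l k ^ n k) ?P"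
  proof (intro cancels_prod cancels_power)
    fix j assume "j \<in> J"
    with insert have *: "j \<in> I" "k \<in> I" "i \<noteq> j" "i \<noteq> k" "k \<noteq> j" by auto
    show "cancels (l i) (l k ^ n k) (l j)"
      by (rule cancels_power_right[OF triple_cancel dvd_cancel]) (use * insert.prems in auto)
  qed
  ultimately have "H \<in> ideal_gen {l i, l k ^ n k}" unfolding cancels_def by blast
  then obtain b c where "H = l i * b + l k ^ n k * c" unfolding ideal_gen_pair by blast
  then have "F = l i * (a + ?P * b) + (l k ^ n k * ?P) * c" using F by (simp add: algebra_simps)
  then show ?case using insert.hyps unfolding ideal_gen_pair by auto
qed

text \<open>The exponents \<open>b\<close> record the factors already divided out, and the case
  \<open>b = 0\<close> describes \<open>sym_pow m\<close>. Each round raises one \<open>b i\<close>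
  with \<open>2 * b i < m\<close>, which lowers the sum of the \<open>m - b i\<close>.\<close>

lemma mem_ideal_gen_mon:
  assumes "\<And>i j. i \<in> I \<Longrightarrow> j \<in> I \<Longrightarrow> i \<noteq> j \<Longrightarrow> F \<in> ideal_pow (ideal_gen {l i, l j}) (m - b i - b j)"
  shows "F \<in> ideal_gen {mon a | a. \<forall>i\<in>I. \<forall>j\<in>I. i \<noteq> j \<longrightarrow> m \<le> a i + a j + b i + b j}"
  using assms
proof (induction "\<Sum>i\<in>I. m - b i" arbitrary: b F rule: less_induct)
  case less
  let ?S = "\<lambda>b. {mon a | a. \<forall>i\<in>I. \<forall>j\<in>I. i \<noteq> j \<longrightarrow> m \<le> a i + a j + b i + b j}"
  show ?case
  proof (cases "\<exists>i\<in>I. 2 * b i < m")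
    case False
    \<comment> \<open>Every pair meets its bound through \<open>b\<close> alone, so the unit
      \<open>mon (\<lambda>_. 0)\<close> is one of the generators.\<close>
    have "m \<le> b j + b k" if "j \<in> I" "k \<in> I" for j k
    proof -
      have "m \<le> 2 * b j" "m \<le> 2 * b k" using False that by (auto simp: not_less)
      then show ?thesis by linarith
    qed
    then have "mon (\<lambda>_. 0) \<in> ?S b" by (intro CollectI exI[of _ "\<lambda>_. 0"]) auto
    then have "F * mon (\<lambda>_. 0) \<in> ideal_gen (?S b)"
      by (intro ideal.subspace_scale is_ideal_ideal_gen ideal_gen_base)
    then show ?thesis by (simp add: mon_def)
  next
    case True
    then obtain i where i: "i \<in> I" "2 * b i < m" by blast
    \<comment> \<open>These exponents make \<open>mon c\<close> the product that divides
      \<open>F\<close> modulo \<open>l i\<close>.\<close>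
    define c where "c j = (if j = i then 0 else m - b i - b j)" for j
    have "mon c = (\<Prod>j\<in>I - {i}. l j ^ (m - b i - b j))"
      unfolding mon_def c_def by (simp add: prod.remove[OF finite_I i(1)])
    moreover have "F \<in> ideal_gen {l i, \<Prod>j\<in>I - {i}. l j ^ (m - b i - b j)}"
      using less.prems i finite_I by (intro mem_ideal_gen_prod) auto
    ultimately obtain G H where F: "F = l i * G + mon c * H"
      unfolding ideal_gen_pair by metis
    \<comment> \<open>Pairs containing \<open>i\<close> are covered by the definition of
      \<open>c\<close>. For other pairs, \<open>c j + b j\<close> and \<open>c k + b k\<close> are
      both at least \<open>m - b i\<close>, and \<open>2 * b i < m\<close>.\<close>
    have c: "m \<le> c j + c k + b j + b k" if "j \<in> I" "k \<in> I" "j \<noteq> k" for j k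
      using i that unfolding c_def by auto
    have "mon c \<in> ideal_gen (?S b)" using c by (intro ideal_gen_base) blast
    moreover have "l i * G \<in> ideal_gen (?S b)"
    proof (rule ideal_gen_mult_left)
      let ?b = "b(i := Suc (b i))"
      show "G \<in> ideal_gen (?S ?b)"
      proof (rule less.hyps)
        show "(\<Sum>j\<in>I. m - ?b j) < (\<Sum>j\<in>I. m - b j)"
          using i by (intro sum_strict_mono_ex1 finite_I) auto
      next
        fix j k assume jk: "j \<in> I" "k \<in> I" "j \<noteq> k"
        have "mon c \<in> ideal_pow (ideal_gen {l j, l k}) (m - b j - b k)"
          using c[OF jk] jk by (intro mon_mem_ideal_pow) auto
        \<comment> \<open>Both \<open>F\<close> and \<open>mon c\<close> lie in the required power,
          hence so does the remainder \<open>l i * G\<close>.\<close>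
        then have "F - H * mon c \<in> ideal_pow (ideal_gen {l j, l k}) (m - b j - b k)"
          using less.prems[OF jk] by (intro ideal.subspace_diff ideal.subspace_scale) auto
        then have *: "l i * G \<in> ideal_pow (ideal_gen {l j, l k}) (m - b j - b k)"
          by (simp add: F mult.commute)
        have dvd: "\<And>G. l j dvd l k * G \<Longrightarrow> l j dvd G" "\<And>G. l k dvd l j * G \<Longrightarrow> l k dvd G"
          using dvd_cancel jk by blast+
        \<comment> \<open>At a point on line \<open>i\<close>, cancelling \<open>l i\<close> costs
          one exponent, which matches the increase of \<open>b i\<close>; at any other point it
          costs nothing.\<close>
        consider "i = j" | "i = k" | "i \<noteq> j" "i \<noteq> k" by blast
        then show "G \<in> ideal_pow (ideal_gen {l j, l k}) (m - ?b j - ?b k)"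
        proof cases
          case 1
          then show ?thesis
            using ideal_pow_pair_cancel_generator[OF dvd(1) nonzero[OF jk(1)] *[unfolded 1]] jk
            by (simp add: diff_right_commute)
        next
          case 2
          with * have "l k * G \<in> ideal_pow (ideal_gen {l k, l j}) (m - b j - b k)"
            by (simp add: insert_commute)
          from ideal_pow_pair_cancel_generator[OF dvd(2) nonzero[OF jk(2)] this] show ?thesis
            using 2 jk by (simp add: diff_right_commute insert_commute)
        next
          case 3
          then show ?thesis
            using ideal_pow_pair_cancel[OF dvd(1) nonzero[OF jk(1)] triple_cancel[of j k i] *] jk i by simp
        qed
      qed
    next
      fix s assume "s \<in> ?S (b(i := Suc (b i)))"
      then obtain a where a: "s = mon a"
        "\<forall>j\<in>I. \<forall>k\<in>I. j \<noteq> k \<longrightarrow> m \<le> a j + a k + (b(i := Suc (b i))) j + (b(i := Suc (b i))) k"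
        by blast
      \<comment> \<open>The factor \<open>l i\<close> moves one unit from \<open>b i\<close> to
        \<open>a i\<close>, leaving all the bounds on sums intact.\<close>
      have "l i * s = mon (a(i := Suc (a i)))" using a(1) i mon_upd by simp
      moreover have "\<forall>j\<in>I. \<forall>k\<in>I. j \<noteq> k \<longrightarrow>
          m \<le> (a(i := Suc (a i))) j + (a(i := Suc (a i))) k + b j + b k"
      proof (intro ballI impI)
        fix j k assume jk: "j \<in> I" "k \<in> I" "j \<noteq> k"
        then have "m \<le> a j + a k + (b(i := Suc (b i))) j + (b(i := Suc (b i))) k"
          using a(2) by blast
        then show "m \<le> (a(i := Suc (a i))) j + (a(i := Suc (a i))) k + b j + b k"
          using jk(3) by (auto split: if_splits)
      qed
      ultimately have "l i * s \<in> ?S b"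
        by (intro CollectI exI[of _ "a(i := Suc (a i))"] conjI)
      then show "l i * s \<in> ideal_gen (?S b)" by (rule ideal_gen_base)
    qed simp
    ultimately show ?thesis
      unfolding F by (simp add: ideal.subspace_add ideal.subspace_scale mult.commute[of "mon c"])
  qed
qed

lemma sym_pow_eq: "sym_pow m = ideal_gen {mon a | a. \<forall>i\<in>I. \<forall>j\<in>I. i \<noteq> j \<longrightarrow> m \<le> a i + a j}"
proof
  show "sym_pow m \<subseteq> ideal_gen {mon a | a. \<forall>i\<in>I. \<forall>j\<in>I. i \<noteq> j \<longrightarrow> m \<le> a i + a j}"
  proof
    fix F assume "F \<in> sym_pow m"
    then show "F \<in> ideal_gen {mon a | a. \<forall>i\<in>I. \<forall>j\<in>I. i \<noteq> j \<longrightarrow> m \<le> a i + a j}"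
      using mem_ideal_gen_mon[of F m "\<lambda>_. 0"] by (auto simp: sym_pow_def)
  qed
  show "ideal_gen {mon a | a. \<forall>i\<in>I. \<forall>j\<in>I. i \<noteq> j \<longrightarrow> m \<le> a i + a j} \<subseteq> sym_pow m"
    by (intro ideal_gen_subset is_ideal_sym_pow) (auto intro!: mon_mem_sym_pow)
qed

text \<open>The pair \<open>(p, q)\<close> is split into \<open>t\<close> pairs of sum
  \<open>m + 1\<close>, each giving a linear form times an element of \<open>sym_pow m\<close>, and
  for \<open>e = 1\<close> a last pair of sum at least \<open>m\<close>. The upper bound on
  \<open>p\<close>, where \<open>(m + 2) div 2\<close> is \<open>m + 1\<close> halved and rounded
  up, keeps the pairs balanced enough for exponents \<open>q\<close> at two other lines to suffice
  as well.\<close>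

lemma mon_mem_ideal_mult_of_bounds:
  assumes M: "\<And>i. i \<in> I \<Longrightarrow> l i \<in> M" and i: "i \<in> I" "I \<noteq> {i}"
    and "p \<le> a i" "\<And>j. j \<in> I \<Longrightarrow> j \<noteq> i \<Longrightarrow> q \<le> a j"
    and "t * (m + 1) + e * m \<le> p + q" "p \<le> t * ((m + 2) div 2) + (e * m) div 2" "e \<le> 1"
  shows "mon a \<in> ideal_mult (ideal_pow M t) (ideal_pow (sym_pow m) (t + e))"
  using assms(4-7)
proof (induction t arbitrary: p q a)
  case 0
  have "mon a \<in> ideal_pow (sym_pow m) e"
  proof (cases "e = 0")
    case False
    with \<open>e \<le> 1\<close> have e: "e = 1" by simp
    have "mon a \<in> sym_pow m"
    proof (rule mon_mem_sym_pow)
      fix j k assume jk: "j \<in> I" "k \<in> I" "j \<noteq> k"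
      \<comment> \<open>Hence also \<open>m \<le> 2 * q\<close>, which handles pairs of lines
        avoiding \<open>i\<close>.\<close>
      have "m \<le> p + q" "2 * p \<le> m" using 0 e by auto
      moreover have "j = i \<or> q \<le> a j" "k = i \<or> q \<le> a k" using 0 jk by auto
      ultimately show "m \<le> a j + a k" using jk(3) 0(1) by auto
    qed
    then show ?thesis using power_mem_ideal_pow[of "mon a" "sym_pow m" 1] e by simp
  qed simp
  then show ?case using ideal_mult_memI[of 1 UNIV "mon a"] by simp
next
  case (Suc t)
  define h where "h = (m + 2) div 2"
  have h: "2 * h \<le> m + 2" by (simp add: h_def)
  \<comment> \<open>As much of \<open>p\<close> as a balanced pair admits is used at once;
    \<open>h\<close> is chosen so that still \<open>m \<le> 2 * q1\<close>.\<close>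
  define p1 q1 where "p1 = min p h" and "q1 = m + 1 - p1"
  have p1: "p1 \<le> p" "p1 \<le> h" by (simp_all add: p1_def)
  have p1q1: "p1 + q1 = m + 1" using h p1 by (simp add: q1_def)
  have e2: "(e * m) div 2 \<le> e * m" by simp
  have p: "p \<le> h + t * h + (e * m) div 2" using Suc.prems(4) by (simp add: h_def)
  have pq: "m + 1 + t * (m + 1) + e * m \<le> p + q" using Suc.prems(3) by simp
  have th: "t * h \<le> t * (m + 1)" using h by (intro mult_le_mono2) simp
  \<comment> \<open>If \<open>p\<close> is exhausted, the bound on \<open>p + q\<close> gives this
    directly. Otherwise \<open>p1 = h\<close>, and the upper bound on \<open>p\<close> leaves enough
    for \<open>q\<close>.\<close>
  have q1: "q1 \<le> q"
  proof (cases "p \<le> h")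
    case True
    then show ?thesis using pq p1q1 by (simp add: p1_def)
  next
    case False
    then show ?thesis using p pq p1q1 th e2 unfolding p1_def by linarith
  qed
  define c where "c j = (if j = i then p1 else q1)" for j
  have c_le: "c j \<le> a j" if "j \<in> I" for j
    using that Suc.prems(1,2) p1 q1 unfolding c_def by (auto intro: le_trans)
  have "mon a = mon (\<lambda>j. c j + (a j - c j))"
    unfolding mon_def using c_le by (intro prod.cong) auto
  then have a: "mon a = mon c * mon (\<lambda>j. a j - c j)" by (simp only: mon_add)
  have IH: "mon (\<lambda>j. a j - c j) \<in> ideal_mult (ideal_pow M t) (ideal_pow (sym_pow m) (t + e))"
  proof (rule Suc.IH)
    show "p - p1 \<le> a i - c i" using Suc.prems(1) by (simp add: c_def diff_le_mono)
    show "q - q1 \<le> a j - c j" if "j \<in> I" "j \<noteq> i" for j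
      using Suc.prems(2)[OF that] that by (simp add: c_def diff_le_mono)
    show "t * (m + 1) + e * m \<le> p - p1 + (q - q1)"
      using pq p1 q1 p1q1 by linarith
    show "p - p1 \<le> t * ((m + 2) div 2) + (e * m) div 2"
      using p unfolding p1_def h_def[symmetric] by (auto simp: min_def)
  qed
  \<comment> \<open>The linear form to remove is the one of line \<open>i\<close>, unless its
    exponent is \<open>0\<close>. In that case \<open>q1 = m + 1\<close>, and any other line can
    give up one factor.\<close>
  obtain k where k: "k \<in> I" "if p1 = 0 then k \<noteq> i else k = i"
    using i by (metis insertI1 subsetI subset_singleton_iff singletonD equals0D)
  define c' where "c' = c(k := c k - 1)"
  have ck: "c k > 0" using k p1q1 by (auto simp: c_def split: if_splits)
  then have "c = c'(k := Suc (c' k))" by (simp add: c'_def)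
  then have "mon c = l k * mon c'" using k(1) mon_upd by metis
  moreover have "mon c' \<in> sym_pow m"
  proof (rule mon_mem_sym_pow)
    fix j n assume jn: "j \<in> I" "n \<in> I" "j \<noteq> n"
    show "m \<le> c' j + c' n"
    proof (cases "p1 = 0")
      case True
      then show ?thesis using k p1q1 jn by (auto simp: c'_def c_def)
    next
      case False
      then show ?thesis using k p1q1 jn h p1 by (auto simp: c'_def c_def)
    qed
  qed
  ultimately show ?case
    unfolding a using ideal_mult_pow_Suc[OF M[OF k(1)] _ IH] by simp
qed

text \<open>It is enough to treat the monomial generators. The case \<open>e = 0\<close> serves (i)
  and (ii), and \<open>e = 1\<close> serves (iii).\<close>

lemma sym_pow_subset:
  assumes "\<And>i. i \<in> I \<Longrightarrow> l i \<in> M" "card I \<ge> 2" "e \<le> 1"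
  shows "sym_pow (t * (m + 1) + e * m) \<subseteq> ideal_mult (ideal_pow M t) (ideal_pow (sym_pow m) (t + e))"
proof -
  define T where "T = t * (m + 1) + e * m"
  have "mon a \<in> ideal_mult (ideal_pow M t) (ideal_pow (sym_pow m) (t + e))"
    if a: "\<forall>i\<in>I. \<forall>j\<in>I. i \<noteq> j \<longrightarrow> T \<le> a i + a j" for a
  proof -
    have "I \<noteq> {}" using assms(2) by auto
    then obtain i where i: "i \<in> I" "\<forall>j\<in>I. a i \<le> a j"
      using finite_I by (metis arg_min_if_finite(1) arg_min_least)
    \<comment> \<open>Here \<open>a i\<close> is the least exponent. Capping it at half of
      \<open>T\<close> yields the upper bound on \<open>p\<close>, while \<open>T - p\<close> still
      bounds the other exponents from below.\<close>
    define p where "p = min (a i) (T div 2)"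
    show ?thesis
    proof (rule mon_mem_ideal_mult_of_bounds[OF assms(1) i(1) _ _ _ _ _ assms(3)])
      show "I \<noteq> {i}" using assms(2) by auto
      show "p \<le> a i" by (simp add: p_def)
      show "T - p \<le> a j" if "j \<in> I" "j \<noteq> i" for j
      proof (cases "a i \<le> T div 2")
        case True
        have "T \<le> a i + a j" using a[rule_format, OF i(1) that(1)] that(2) by simp
        then show ?thesis using True by (simp add: p_def)
      next
        case False
        moreover have "a i \<le> a j" using i(2) that by blast
        ultimately show ?thesis by (simp add: p_def)
      qed
      show "t * (m + 1) + e * m \<le> p + (T - p)" by (simp add: p_def T_def)
      have "t * (m + 1) \<le> t * (2 * ((m + 2) div 2))" by (intro mult_le_mono2) presburger
      then have "T \<le> e * m + 2 * (t * ((m + 2) div 2))" by (simp add: T_def)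
      then have "T div 2 \<le> (e * m + 2 * (t * ((m + 2) div 2))) div 2" by (rule div_le_mono)
      also have "\<dots> = t * ((m + 2) div 2) + (e * m) div 2" by simp
      finally show "p \<le> t * ((m + 2) div 2) + (e * m) div 2" by (simp add: p_def)
    qed
  qed
  then show ?thesis
    unfolding sym_pow_eq T_def[symmetric] by (intro ideal_gen_subset) auto
qed

end

section \<open>Substitution and linear forms\<close>

abbreviation const3 :: "'k::comm_ring_1 \<Rightarrow> 'k poly3" where
  "const3 \<equiv> Poly_Mapping.single 0"

lemma const3_mult: "const3 (a * b) = const3 a * const3 b"
  by (simp add: mult_single)

lemma const3_power: "const3 (a ^ n) = const3 a ^ n"
  by (induction n) (simp_all add: const3_mult)

lemma const3_prod: "const3 (\<Prod>i\<in>A. f i) = (\<Prod>i\<in>A. const3 (f i))"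
  by (induction A rule: infinite_finite_induct) (simp_all add: const3_mult)

lemma const3_sum: "const3 (\<Sum>i\<in>A. f i) = (\<Sum>i\<in>A. const3 (f i))"
  by (induction A rule: infinite_finite_induct) (simp_all add: single_add)

lemma variable_power: "variable i ^ n = Poly_Mapping.single (Poly_Mapping.single i n) 1"
  by (induction n) (simp_all add: variable_def mult_single single_add[symmetric])

lemma prod_single:
  "(\<Prod>i\<in>A. Poly_Mapping.single (f i) 1) = Poly_Mapping.single (\<Sum>i\<in>A. f i) (1 :: 'k::comm_ring_1)"
  by (induction A rule: infinite_finite_induct) (simp_all add: mult_single)

lemma sum_single: "(\<Sum>i\<in>Poly_Mapping.keys F. Poly_Mapping.single i (Poly_Mapping.lookup F i)) = F"
  by (intro poly_mapping_eqI) (auto simp: lookup_sum lookup_single when_def in_keys_iff sum.delta)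

lemma sum_single_UNIV:
  fixes e :: "'a::finite \<Rightarrow>\<^sub>0 'b::comm_monoid_add"
  shows "(\<Sum>i\<in>UNIV. Poly_Mapping.single i (Poly_Mapping.lookup e i)) = e"
  by (intro poly_mapping_eqI) (auto simp: lookup_sum lookup_single when_def sum.delta)

lemma single_eq_prod_variable:
  "Poly_Mapping.single e c = const3 c * (\<Prod>i\<in>UNIV. variable i ^ Poly_Mapping.lookup e i)"
  by (simp add: variable_power prod_single sum_single_UNIV mult_single)

lemma poly3_induct [case_names single add]:
  assumes "\<And>e c. P (Poly_Mapping.single e c)" "\<And>F G. P F \<Longrightarrow> P G \<Longrightarrow> P (F + G)"
  shows "P (F :: 'k::comm_ring_1 poly3)"
proof -
  have "P (\<Sum>i\<in>A. Poly_Mapping.single i (Poly_Mapping.lookup F i))" for A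
    by (induction A rule: infinite_finite_induct) (use assms assms(1)[of 0 0] in auto)
  from this[of "Poly_Mapping.keys F"] show ?thesis by (simp add: sum_single)
qed

section \<open>Substitution homomorphisms\<close>

definition subst3 :: "(3 \<Rightarrow> 'k::comm_ring_1 poly3) \<Rightarrow> 'k poly3 \<Rightarrow> 'k poly3" where
  "subst3 g F = (\<Sum>e\<in>Poly_Mapping.keys F.
     const3 (Poly_Mapping.lookup F e) * (\<Prod>i\<in>UNIV. g i ^ Poly_Mapping.lookup e i))"

text \<open>Enlarging the index set lets \<open>F\<close>, \<open>G\<close> and \<open>F + G\<close>
  be summed over a common one.\<close>

lemma subst3_superset:
  assumes "finite A" "Poly_Mapping.keys F \<subseteq> A"
  shows "subst3 g F = (\<Sum>e\<in>A.
     const3 (Poly_Mapping.lookup F e) * (\<Prod>i\<in>UNIV. g i ^ Poly_Mapping.lookup e i))"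
  unfolding subst3_def using assms
  by (intro sum.mono_neutral_left) (auto simp: in_keys_iff)

lemma subst3_add: "subst3 g (F + G) = subst3 g F + subst3 g G"
proof -
  let ?A = "Poly_Mapping.keys F \<union> Poly_Mapping.keys G"
  have "Poly_Mapping.keys (F + G) \<subseteq> ?A" by (rule keys_add)
  then show ?thesis
    by (simp add: subst3_superset[of ?A] lookup_add single_add distrib_right sum.distrib)
qed

lemma subst3_zero [simp]: "subst3 g 0 = 0"
  by (simp add: subst3_def)

lemma subst3_sum: "subst3 g (\<Sum>i\<in>A. f i) = (\<Sum>i\<in>A. subst3 g (f i))"
  by (induction A rule: infinite_finite_induct) (simp_all add: subst3_add)

lemma subst3_single:
  "subst3 g (Poly_Mapping.single e c) = const3 c * (\<Prod>i\<in>UNIV. g i ^ Poly_Mapping.lookup e i)"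
  by (simp add: subst3_superset[of "{e}"])

lemma subst3_mult: "subst3 g (F * G) = subst3 g F * subst3 g G"
proof (induction F rule: poly3_induct)
  case (single e c)
  show ?case
  proof (induction G rule: poly3_induct)
    case (single f d)
    show ?case
      unfolding mult_single[of e] subst3_single lookup_add power_add prod.distrib const3_mult
      by (simp only: ac_simps)
  qed (simp add: distrib_left subst3_add)
qed (simp add: distrib_right subst3_add)

lemma subst3_const: "subst3 g (const3 c) = const3 c"
  by (simp add: subst3_single)

lemma subst3_variable: "subst3 g (variable i) = g i"
proof -
  have "(\<Prod>j\<in>UNIV. g j ^ Poly_Mapping.lookup (Poly_Mapping.single i 1) j)
      = (\<Prod>j\<in>UNIV. if j = i then g j else 1)"
    by (intro prod.cong) (auto simp: lookup_single when_def)
  then show ?thesis unfolding variable_def subst3_single by simp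
qed

lemma ideal_diff_mult:
  assumes J: "is_ideal J" and "a - a' \<in> J" "b - b' \<in> J"
  shows "a * b - a' * b' \<in> J"
proof -
  have "b * (a - a') + a' * (b - b') \<in> J"
    using assms by (intro ideal.subspace_add ideal.subspace_scale)
  then show ?thesis by (simp add: algebra_simps)
qed

lemma ideal_diff_power: "is_ideal J \<Longrightarrow> a - a' \<in> J \<Longrightarrow> a ^ n - a' ^ n \<in> J"
  by (induction n) (simp_all add: ideal.subspace_0 ideal_diff_mult)

lemma ideal_diff_prod:
  "is_ideal J \<Longrightarrow> (\<And>i. i \<in> A \<Longrightarrow> f i - g i \<in> J) \<Longrightarrow> (\<Prod>i\<in>A. f i) - (\<Prod>i\<in>A. g i) \<in> J"
  by (induction A rule: infinite_finite_induct) (simp_all add: ideal.subspace_0 ideal_diff_mult)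

text \<open>Congruence modulo \<open>J\<close> respects sums and products, so a substitution
  congruent to the identity on the variables is so on every polynomial.\<close>

lemma diff_subst3_mem:
  assumes J: "is_ideal J" and "\<And>i. variable i - g i \<in> J"
  shows "F - subst3 g F \<in> J"
proof (induction F rule: poly3_induct)
  case (single e c)
  have "(\<Prod>i\<in>UNIV. variable i ^ Poly_Mapping.lookup e i) - (\<Prod>i\<in>UNIV. g i ^ Poly_Mapping.lookup e i) \<in> J"
    using assms by (intro ideal_diff_prod ideal_diff_power)
  from ideal.subspace_scale[OF J this, of "const3 c"] show ?case
    by (simp only: subst3_single right_diff_distrib single_eq_prod_variable[symmetric])
next
  case (add F G)
  then have "(F - subst3 g F) + (G - subst3 g G) \<in> J" by (rule ideal.subspace_add[OF J])
  then show ?case by (simp add: subst3_add algebra_simps)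
qed

text \<open>Homogeneity pulls \<open>H\<close> out of every term with the same exponent
  \<open>d\<close>. Vanishing of a form at \<open>v\<close> thereby becomes membership in the kernel
  of a substitution.\<close>

lemma subst3_scaled_const:
  assumes "form d F"
  shows "subst3 (\<lambda>i. const3 (v $ i) * H) F = const3 (eval3 F v) * H ^ d"
proof -
  have "const3 (Poly_Mapping.lookup F e) * (\<Prod>i\<in>UNIV. (const3 (v $ i) * H) ^ Poly_Mapping.lookup e i)
      = const3 (Poly_Mapping.lookup F e * (\<Prod>i\<in>UNIV. v $ i ^ Poly_Mapping.lookup e i)) * H ^ d"
    if "e \<in> Poly_Mapping.keys F" for e
  proof -
    have "(\<Sum>i\<in>UNIV. Poly_Mapping.lookup e i) = d" using assms that by (simp add: form_def)
    then show ?thesis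
      by (simp add: power_mult_distrib prod.distrib power_sum[symmetric] const3_mult const3_prod
          const3_power mult.assoc)
  qed
  then show ?thesis
    unfolding subst3_def eval3_def const3_sum sum_distrib_right by (intro sum.cong) auto
qed

section \<open>Linear forms and their coefficient vectors\<close>

definition dot3 :: "'k::comm_ring_1 ^ 3 \<Rightarrow> 'k ^ 3 \<Rightarrow> 'k" where
  "dot3 a v = (\<Sum>i\<in>UNIV. a $ i * v $ i)"

definition linear_form :: "'k::comm_ring_1 ^ 3 \<Rightarrow> 'k poly3" where
  "linear_form a = (\<Sum>i\<in>UNIV. const3 (a $ i) * variable i)"

lemma linear_form_eq_sum_single:
  "linear_form a = (\<Sum>i\<in>UNIV. Poly_Mapping.single (Poly_Mapping.single i 1) (a $ i))"
  by (simp add: linear_form_def variable_def mult_single)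

lemma single_Suc_0_eq_iff:
  "Poly_Mapping.single i (Suc 0) = Poly_Mapping.single j (Suc 0) \<longleftrightarrow> i = j"
proof
  assume "Poly_Mapping.single i (Suc 0) = Poly_Mapping.single j (Suc 0)"
  then have "Poly_Mapping.keys (Poly_Mapping.single i (Suc 0)) = Poly_Mapping.keys (Poly_Mapping.single j (Suc 0))"
    by (rule arg_cong)
  then show "i = j" by simp
qed simp

lemma lookup_linear_form: "Poly_Mapping.lookup (linear_form a) (Poly_Mapping.single i 1) = a $ i"
  by (simp add: linear_form_eq_sum_single lookup_sum lookup_single when_def
      single_Suc_0_eq_iff)

lemma linear_form_eq_0_iff: "linear_form a = 0 \<longleftrightarrow> a = 0"
proof
  assume "linear_form a = 0"
  then have "a $ i = 0" for i using lookup_linear_form[of a i] by simp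
  then show "a = 0" by (simp add: vec_eq_iff)
qed (simp add: linear_form_def)

lemma linear_form_add: "linear_form (a + b) = linear_form a + linear_form b"
  by (simp add: linear_form_def single_add distrib_right sum.distrib)

lemma linear_form_diff: "linear_form (a - b) = linear_form a - linear_form b"
  by (simp add: linear_form_def single_diff left_diff_distrib sum_subtractf)

lemma linear_form_scale: "linear_form (c *s a) = const3 c * linear_form a"
  by (simp add: linear_form_def const3_mult sum_distrib_left mult.assoc)

lemma linear_form_axis: "linear_form (axis i 1) = variable i"
proof -
  have "linear_form (axis i 1) = (\<Sum>j\<in>UNIV. if j = i then variable j else 0)"
    unfolding linear_form_def by (intro sum.cong) (auto simp: axis_def)
  then show ?thesis by simp
qed

lemma subst3_linear_form: "subst3 g (linear_form a) = (\<Sum>i\<in>UNIV. const3 (a $ i) * g i)"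
  by (simp add: linear_form_def subst3_sum subst3_mult subst3_const subst3_variable)

lemma sum_lookup_single: "(\<Sum>i\<in>UNIV. Poly_Mapping.lookup (Poly_Mapping.single (j::3) (1::nat)) i) = 1"
  by (simp add: lookup_single when_def sum.delta)

lemma form_linear_form: "form 1 (linear_form a)"
proof -
  have "Poly_Mapping.keys (linear_form a) \<subseteq> range (\<lambda>i. Poly_Mapping.single i 1)"
    unfolding linear_form_eq_sum_single by (rule order.trans[OF keys_sum]) auto
  then show ?thesis unfolding form_def using sum_lookup_single by auto
qed

text \<open>An exponent vector of total degree 1 is a unit vector, so the coefficients at the unit
  vectors determine \<open>F\<close>.\<close>

lemma form_1_imp_linear_form:
  assumes "form 1 F"
  shows "\<exists>a. F = linear_form a"
proof (intro exI poly_mapping_eqI)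
  fix e
  let ?a = "\<chi> i. Poly_Mapping.lookup F (Poly_Mapping.single i 1)"
  show "Poly_Mapping.lookup F e = Poly_Mapping.lookup (linear_form ?a) e"
  proof (cases "(\<Sum>i\<in>UNIV. Poly_Mapping.lookup e i) = 1")
    case True
    then obtain j where j: "Poly_Mapping.lookup e j = 1" "\<And>i. i \<noteq> j \<Longrightarrow> Poly_Mapping.lookup e i = 0"
      unfolding sum_eq_1_iff[OF finite] by (metis UNIV_I)
    then have "e = Poly_Mapping.single j 1"
      by (intro poly_mapping_eqI) (auto simp: lookup_single when_def)
    then show ?thesis using lookup_linear_form[of ?a j] by simp
  next
    case False
    then have "e \<notin> Poly_Mapping.keys F" "e \<notin> Poly_Mapping.keys (linear_form ?a)"
      using assms form_linear_form[of ?a] unfolding form_def by blast+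
    then show ?thesis by (simp add: in_keys_iff)
  qed
qed

lemma eval3_linear_form: "eval3 (linear_form a) v = dot3 a v"
proof -
  have "const3 (eval3 (linear_form a) v) = subst3 (\<lambda>i. const3 (v $ i) * 1) (linear_form a)"
    using subst3_scaled_const[OF form_linear_form, of v 1 a] by simp
  also have "\<dots> = const3 (dot3 a v)"
    by (simp add: subst3_linear_form dot3_def const3_sum const3_mult)
  finally show ?thesis by (metis lookup_single_eq)
qed

lemma linear_form_mem_irrelevant_ideal: "linear_form a \<in> irrelevant_ideal"
  unfolding linear_form_def irrelevant_ideal_def
  by (intro ideal.subspace_sum ideal.subspace_scale ideal_gen_base) auto

section \<open>Lines and points\<close>

lemma dot3_add_left: "dot3 (a + b) v = dot3 a v + dot3 b v"
  by (simp add: dot3_def distrib_right sum.distrib)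

lemma dot3_diff_left: "dot3 (a - b) v = dot3 a v - dot3 b v"
  by (simp add: dot3_def left_diff_distrib sum_subtractf)

lemma dot3_scale_left: "dot3 (c *s a) v = c * dot3 a v"
  by (simp add: dot3_def sum_distrib_left mult.assoc)

lemma dot3_scale_right: "dot3 a (c *s v) = c * dot3 a v"
  by (simp add: dot3_def sum_distrib_left mult.left_commute)

lemma dot3_commute: "dot3 a b = dot3 b a"
  by (simp add: dot3_def mult.commute)

lemma dot3_axis: "dot3 (axis i x) v = x * v $ i"
proof -
  have "dot3 (axis i x) v = (\<Sum>j\<in>UNIV. if j = i then x * v $ j else 0)"
    unfolding dot3_def by (intro sum.cong) (auto simp: axis_def)
  then show ?thesis by simp
qed

lemma ex_dot3_eq_1:
  fixes v :: "'k::field ^ 3"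
  assumes "v \<noteq> 0"
  shows "\<exists>w. dot3 w v = 1"
proof -
  obtain i where "v $ i \<noteq> 0" using assms by (auto simp: vec_eq_iff)
  then have "dot3 (axis i (1 / v $ i)) v = 1" by (simp add: dot3_axis)
  then show ?thesis by blast
qed

text \<open>The square matrix with rows \<open>a\<close>, \<open>b\<close> and \<open>0\<close> is
  not invertible, so its kernel is nontrivial. The index \<open>3\<close> denotes the zero
  row.\<close>

lemma ex_common_zero:
  fixes a b :: "'k::field ^ 3"
  shows "\<exists>v. v \<noteq> 0 \<and> dot3 a v = 0 \<and> dot3 b v = 0"
proof (rule ccontr)
  assume none: "\<not> ?thesis"
  define A :: "'k ^ 3 ^ 3" where "A = (\<chi> i. if i = 1 then a else if i = 2 then b else 0)"
  have A: "(A *v v) $ i = dot3 (A $ i) v" for v i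
    by (simp add: matrix_vector_mult_def dot3_def)
  have "v = 0" if "A *v v = 0" for v
  proof -
    have "dot3 a v = 0" using A[of v 1] that by (simp add: A_def)
    moreover have "dot3 b v = 0" using A[of v 2] that by (simp add: A_def)
    ultimately show ?thesis using none by blast
  qed
  then obtain B where "B ** A = mat 1" using matrix_left_invertible_ker[of A] by blast
  then have "A ** B = mat 1" by (simp add: matrix_left_right_inverse)
  then have "(A ** B) $ 3 $ 3 = 1" by (simp add: mat_def)
  then show False by (simp add: matrix_matrix_mult_def A_def)
qed

text \<open>The linear forms vanishing at \<open>v\<close> are a proper subspace of a 3-dimensional
  space, so the two independent members \<open>a\<close> and \<open>b\<close> span it.\<close>

lemma dot3_zero_imp_span:
  fixes a b d v :: "'k::field ^ 3"
  assumes "a \<noteq> 0" "\<And>k. b \<noteq> k *s a" "v \<noteq> 0" "dot3 a v = 0" "dot3 b v = 0" "dot3 d v = 0"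
  shows "\<exists>x y. d = x *s a + y *s b"
proof -
  let ?V = "{d. dot3 d v = 0}"
  have V: "vec.subspace ?V"
    by (intro vec.subspaceI) (auto simp: dot3_add_left dot3_scale_left, simp add: dot3_def)
  obtain w where "dot3 w v = 1" using ex_dot3_eq_1 assms(3) by blast
  then have "w \<notin> ?V" by simp
  then have "vec.span ?V \<subset> vec.span UNIV"
    using V by (auto simp: vec.span_eq_iff[THEN iffD2])
  then have "vec.dim ?V < vec.dim (UNIV :: ('k ^ 3) set)" by (rule vec.dim_psubset)
  then have dim: "vec.dim ?V \<le> 2" unfolding vec_dim_card by simp
  have b: "b \<notin> vec.span {a}" using assms(2) by (auto simp: vec.span_singleton)
  then have "a \<noteq> b" using vec.span_base by blast
  have "vec.independent {b, a}"
    using assms(1) b by (intro vec.independent_insertI) (auto simp: vec.independent_insert vec.independent_empty)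
  then have "?V \<subseteq> vec.span {b, a}"
    using dim assms \<open>a \<noteq> b\<close> by (intro vec.card_ge_dim_independent) auto
  then have "d \<in> vec.span {b, a}" using assms by auto
  then obtain y x where "d - y *s b - x *s a = 0"
    unfolding vec.span_breakdown_eq vec.span_empty by auto
  then have "d = x *s a + y *s b" by (simp add: algebra_simps)
  then show ?thesis by blast
qed

section \<open>The prime ideals of a line and of a point\<close>

context
  fixes a :: "'k::field ^ 3" and b :: "'k ^ 3"
  assumes a: "a \<noteq> 0" and ab: "\<And>k. b \<noteq> k *s a"
begin

text \<open>The ideal generated by the linear form is the kernel of the pullback along a linear projection onto
  its plane of zeros in \<open>K\<^sup>3\<close>; a kernel of an endomorphism of a domain is prime.\<close>

lemma linear_form_dvd_cancel:
  assumes "linear_form a dvd linear_form b * G"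
  shows "linear_form a dvd G"
proof -
  obtain w where "dot3 w a = 1" using ex_dot3_eq_1 a by blast
  then have w: "dot3 a w = 1" by (simp add: dot3_commute)
  \<comment> \<open>Pullback along the projection with direction \<open>w\<close>: it kills the form
    of \<open>a\<close>, but not that of \<open>b\<close>, because \<open>b\<close> is not a
    multiple of \<open>a\<close>.\<close>
  define s where "s = subst3 (\<lambda>i. variable i - const3 (w $ i) * linear_form a)"
  have s_lin: "s (linear_form c) = linear_form (c - dot3 c w *s a)" for c
    unfolding s_def subst3_linear_form linear_form_diff linear_form_scale
    by (simp add: right_diff_distrib sum_subtractf linear_form_def[of c, symmetric]
        dot3_def const3_sum const3_mult sum_distrib_right mult.assoc)
  have "is_ideal {F. linear_form a dvd F}"
    by (intro ideal.subspaceI) auto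
  then have "G - s G \<in> {F. linear_form a dvd F}"
    unfolding s_def by (rule diff_subst3_mem) simp
  moreover have "s (linear_form a) = 0"
    by (simp add: s_lin w linear_form_eq_0_iff)
  then have "s (linear_form b) * s G = 0"
    using assms by (auto simp: dvd_def s_def subst3_mult[symmetric]) (simp add: subst3_mult)
  moreover have "s (linear_form b) \<noteq> 0"
    using ab by (simp add: s_lin linear_form_eq_0_iff)
  ultimately show ?thesis by simp
qed

context
  fixes v :: "'k ^ 3"
  assumes v: "v \<noteq> 0" "dot3 a v = 0" "dot3 b v = 0"
begin

text \<open>Likewise, the ideal of the point is the kernel of the pullback along a linear projection of \<open>K\<^sup>3\<close>
  onto the span of \<open>v\<close>.\<close>

lemma ex_projection:
  obtains H where "H \<noteq> 0"
    "\<And>F. subst3 (\<lambda>i. const3 (v $ i) * H) F = 0 \<longleftrightarrow> F \<in> ideal_gen {linear_form a, linear_form b}"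
proof -
  let ?J = "ideal_gen {linear_form a, linear_form b}"
  obtain c where c: "dot3 c v = 1" using ex_dot3_eq_1 v(1) by blast
  \<comment> \<open>Pullback along the map sending \<open>x\<close> to \<open>dot3 c x\<close> times
    \<open>v\<close>, which fixes \<open>v\<close> because \<open>dot3 c v = 1\<close>.\<close>
  define s where "s = subst3 (\<lambda>i. const3 (v $ i) * linear_form c)"
  have "variable i - const3 (v $ i) * linear_form c \<in> ?J" for i
  proof -
    have "dot3 (axis i 1 - v $ i *s c) v = 0"
      by (simp add: dot3_diff_left dot3_scale_left dot3_axis c)
    then obtain x y where "axis i 1 - v $ i *s c = x *s a + y *s b"
      using dot3_zero_imp_span[OF a ab v] by blast
    then have "linear_form (axis i 1 - v $ i *s c) = linear_form (x *s a + y *s b)" by simp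
    then have "variable i - const3 (v $ i) * linear_form c
        = linear_form a * const3 x + linear_form b * const3 y"
      by (simp add: linear_form_diff linear_form_add linear_form_scale linear_form_axis mult.commute)
    then show ?thesis unfolding ideal_gen_pair by blast
  qed
  then have diff: "F - s F \<in> ?J" for F unfolding s_def by (intro diff_subst3_mem) simp_all
  have "s (linear_form d) = const3 (dot3 d v) * linear_form c" for d
    using subst3_scaled_const[OF form_linear_form] by (simp add: s_def eval3_linear_form)
  then have ab0: "s (linear_form a) = 0" "s (linear_form b) = 0" by (simp_all add: v)
  show ?thesis
  proof (rule that)
    have "c \<noteq> 0" using c by (auto simp: dot3_def)
    then show "linear_form c \<noteq> 0" by (simp add: linear_form_eq_0_iff)
    fix F
    show "subst3 (\<lambda>i. const3 (v $ i) * linear_form c) F = 0 \<longleftrightarrow> F \<in> ?J"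
    proof
      assume "subst3 (\<lambda>i. const3 (v $ i) * linear_form c) F = 0"
      then show "F \<in> ?J" using diff[of F] by (simp add: s_def)
    next
      assume "F \<in> ?J"
      then obtain A B where "F = linear_form a * A + linear_form b * B"
        unfolding ideal_gen_pair by blast
      then have "s F = 0" using ab0 by (simp add: s_def subst3_add subst3_mult)
      then show "subst3 (\<lambda>i. const3 (v $ i) * linear_form c) F = 0" by (simp add: s_def)
    qed
  qed
qed

text \<open>The projection sends the form of \<open>d\<close> to a nonzero multiple of
  \<open>H\<close>, which cancels in the domain.\<close>

lemma cancels_linear_form:
  assumes "dot3 d v \<noteq> 0"
  shows "cancels (linear_form a) (linear_form b) (linear_form d)"
proof -
  obtain H where H: "H \<noteq> 0"
    "\<And>F. subst3 (\<lambda>i. const3 (v $ i) * H) F = 0 \<longleftrightarrow> F \<in> ideal_gen {linear_form a, linear_form b}"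
    using ex_projection by blast
  have "subst3 (\<lambda>i. const3 (v $ i) * H) (linear_form d) = const3 (dot3 d v) * H"
    using subst3_scaled_const[OF form_linear_form] by (simp add: eval3_linear_form)
  moreover have "const3 (dot3 d v) \<noteq> 0" using assms by (metis lookup_single_eq lookup_zero)
  ultimately show ?thesis
    unfolding cancels_def H(2)[symmetric] subst3_mult using H(1) by simp
qed

text \<open>A form vanishing at \<open>v\<close> is killed by the projection, hence lies in its
  kernel \<open>?J\<close>; conversely, the two generators are themselves forms vanishing at the
  point.\<close>

lemma point_ideal_eq:
  "point_ideal (proj_rel `` {v}) = ideal_gen {linear_form a, linear_form b}" (is "_ = ?J")
proof
  obtain H where H: "H \<noteq> 0"
    "\<And>F. subst3 (\<lambda>i. const3 (v $ i) * H) F = 0 \<longleftrightarrow> F \<in> ?J"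
    using ex_projection by blast
  show "point_ideal (proj_rel `` {v}) \<subseteq> ?J"
    unfolding point_ideal_def
  proof (intro ideal_gen_subset subsetI)
    fix F assume "F \<in> {F. (\<exists>d. form d F) \<and> vanishes_at F (proj_rel `` {v})}"
    then obtain d where d: "form d F" "vanishes_at F (proj_rel `` {v})" by blast
    have "v \<in> proj_rel `` {v}" using v(1) by (auto simp: proj_rel_def intro!: exI[of _ 1])
    then have "eval3 F v = 0" using d(2) by (simp add: vanishes_at_def)
    then show "F \<in> ?J" using subst3_scaled_const[OF d(1), of v H] H(2) by simp
  qed simp
  show "?J \<subseteq> point_ideal (proj_rel `` {v})"
    unfolding point_ideal_def
  proof (rule ideal_gen_subset)
    have "vanishes_at (linear_form d) (proj_rel `` {v})" if "dot3 d v = 0" for d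
      using that by (auto simp: vanishes_at_def proj_rel_def eval3_linear_form dot3_scale_right)
    then show "{linear_form a, linear_form b} \<subseteq>
        ideal_gen {F. (\<exists>d. form d F) \<and> vanishes_at F (proj_rel `` {v})}"
      using v form_linear_form by (auto intro!: ideal_gen_base)
  qed simp
qed

end

end

lemma vanishes_at_linear_form:
  "v \<noteq> 0 \<Longrightarrow> vanishes_at (linear_form a) (proj_rel `` {v}) \<longleftrightarrow> dot3 a v = 0"
  by (auto simp: vanishes_at_def proj_rel_def eval3_linear_form dot3_scale_right intro!: exI[of _ 1])

lemma proj_plane_eq: "proj_plane = {proj_rel `` {v} | v. v \<noteq> 0}"
  by (auto simp: proj_plane_def quotient_def)

definition line_of :: "'k::field ^ 3 \<Rightarrow> ('k ^ 3) set set" where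
  "line_of a = {proj_rel `` {v} | v. v \<noteq> 0 \<and> dot3 a v = 0}"

lemma line_of_eq: "line_of a = {P \<in> proj_plane. vanishes_at (linear_form a) P}"
  using vanishes_at_linear_form by (fastforce simp: line_of_def proj_plane_eq)

lemma proj_line_imp_line_of: "proj_line L \<Longrightarrow> \<exists>a. a \<noteq> 0 \<and> L = line_of a"
  unfolding proj_line_def line_of_eq
  by (metis form_1_imp_linear_form linear_form_eq_0_iff)

lemma mem_line_of: "v \<noteq> 0 \<Longrightarrow> proj_rel `` {v} \<in> line_of a \<longleftrightarrow> dot3 a v = 0"
  by (auto simp: line_of_eq vanishes_at_linear_form proj_plane_eq)

lemma line_of_scale: "k \<noteq> 0 \<Longrightarrow> line_of (k *s a) = line_of a"
  by (simp add: line_of_def dot3_scale_left)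

section \<open>Degrees\<close>

definition total_degree :: "(3 \<Rightarrow>\<^sub>0 nat) \<Rightarrow> nat" where
  "total_degree e = (\<Sum>i\<in>UNIV. Poly_Mapping.lookup e i)"

lemma total_degree_add: "total_degree (e + f) = total_degree e + total_degree f"
  by (simp add: total_degree_def lookup_add sum.distrib)

lemma form_altdef: "form d F \<longleftrightarrow> (\<forall>e\<in>Poly_Mapping.keys F. total_degree e = d)"
  by (simp add: form_def total_degree_def)

lemma form_mult: "form c F \<Longrightarrow> form d G \<Longrightarrow> form (c + d) (F * G)"
  unfolding form_altdef using keys_mult[of F G] by (fastforce simp: total_degree_add)

lemma form_one: "form 0 1"
  by (simp add: form_def)

lemma form_power: "form d F \<Longrightarrow> form (d * n) (F ^ n)"
  by (induction n) (simp_all add: form_one form_mult)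

lemma form_prod: "(\<And>i. i \<in> A \<Longrightarrow> form (d i) (f i)) \<Longrightarrow> form (\<Sum>i\<in>A. d i) (\<Prod>i\<in>A. f i)"
  by (induction A rule: infinite_finite_induct) (simp_all add: form_one form_mult)

text \<open>This is the \<open>d\<close>-th power of the irrelevant ideal, given by a condition on
  exponents so that degrees can be compared without homogeneous decompositions.\<close>

definition order_ge :: "nat \<Rightarrow> 'k::comm_ring_1 poly3 set" where
  "order_ge d = {F. \<forall>e\<in>Poly_Mapping.keys F. d \<le> total_degree e}"

lemma mult_mem_order_ge: "F \<in> order_ge c \<Longrightarrow> G \<in> order_ge d \<Longrightarrow> F * G \<in> order_ge (c + d)"
  unfolding order_ge_def using keys_mult[of F G] by (fastforce simp: total_degree_add intro: add_mono)

lemma is_ideal_order_ge [simp]: "is_ideal (order_ge d)"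
proof (intro ideal.subspaceI)
  show "F + G \<in> order_ge d" if "F \<in> order_ge d" "G \<in> order_ge d" for F G :: "'a poly3"
    using that keys_add[of F G] unfolding order_ge_def by blast
  have "c \<in> order_ge 0" for c :: "'a poly3" by (simp add: order_ge_def)
  then show "c * F \<in> order_ge d" if "F \<in> order_ge d" for c F :: "'a poly3"
    using mult_mem_order_ge[of c 0 F d] that by simp
qed (simp add: order_ge_def)

lemma ideal_mult_subset_order_ge:
  "A \<subseteq> order_ge c \<Longrightarrow> B \<subseteq> order_ge d \<Longrightarrow> ideal_mult A B \<subseteq> order_ge (c + d)"
  by (intro ideal_mult_subset is_ideal_order_ge) (blast intro: mult_mem_order_ge)

lemma ideal_pow_subset_order_ge: "J \<subseteq> order_ge d \<Longrightarrow> ideal_pow J n \<subseteq> order_ge (n * d)"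
proof (induction n)
  case 0
  show ?case by (simp add: order_ge_def)
next
  case (Suc n)
  then show ?case using ideal_mult_subset_order_ge[of J d "ideal_pow J n" "n * d"] by simp
qed

lemma form_imp_order_ge: "form d F \<Longrightarrow> F \<in> order_ge d"
  by (simp add: form_altdef order_ge_def)

lemma irrelevant_ideal_subset_order_ge: "irrelevant_ideal \<subseteq> order_ge 1"
  unfolding irrelevant_ideal_def
proof (rule ideal_gen_subset)
  have "form 1 (variable i)" for i by (metis form_linear_form linear_form_axis)
  then show "range variable \<subseteq> order_ge 1" by (blast intro: form_imp_order_ge)
qed simp

lemma form_le_of_order_ge:
  assumes "form c F" "F \<noteq> 0" "F \<in> order_ge d"
  shows "d \<le> c"
proof -
  obtain e where "e \<in> Poly_Mapping.keys F"
    using assms(2) poly_mapping_eqI[of F 0] by (auto simp: in_keys_iff)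
  then show ?thesis using assms by (auto simp: form_altdef order_ge_def)
qed

section \<open>Least degrees in the symbolic powers\<close>

locale linear_star_configuration = star_configuration I "\<lambda>i. linear_form (c i)"
  for I :: "'i set" and c :: "'i \<Rightarrow> 'k::field ^ 3" +
  assumes two: "card I \<ge> 2"
begin

lemma form_mon: "form (\<Sum>i\<in>I. a i) (mon a)"
  unfolding mon_def using form_power[OF form_linear_form] by (intro form_prod) simp

text \<open>\<open>alpha\<close> only bounds the degrees of forms, but the generators
  \<open>mon a\<close> are forms, so the bound extends to every term of every element.\<close>

lemma sym_pow_subset_order_ge_alpha: "sym_pow m \<subseteq> order_ge (alpha (sym_pow m))"
proof -
  have "mon a \<in> order_ge (alpha (sym_pow m))"
    if "\<forall>i\<in>I. \<forall>j\<in>I. i \<noteq> j \<longrightarrow> m \<le> a i + a j" for a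
  proof -
    have "mon a \<in> sym_pow m" using that by (intro mon_mem_sym_pow) auto
    then have "alpha (sym_pow m) \<le> (\<Sum>i\<in>I. a i)"
      unfolding alpha_def using mon_nonzero form_mon by (intro Least_le) blast
    moreover have "mon a \<in> order_ge (\<Sum>i\<in>I. a i)" using form_mon by (rule form_imp_order_ge)
    ultimately show ?thesis unfolding order_ge_def by auto
  qed
  then have "ideal_gen {mon a | a. \<forall>i\<in>I. \<forall>j\<in>I. i \<noteq> j \<longrightarrow> m \<le> a i + a j}
      \<subseteq> order_ge (alpha (sym_pow m))"
    by (intro ideal_gen_subset is_ideal_order_ge) blast
  then show ?thesis by (simp only: sym_pow_eq[symmetric])
qed

lemma sym_pow_subset_irrelevant:
  "e \<le> 1 \<Longrightarrow> sym_pow (t * (m + 1) + e * m)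
     \<subseteq> ideal_mult (ideal_pow irrelevant_ideal t) (ideal_pow (sym_pow m) (t + e))"
  using linear_form_mem_irrelevant_ideal two by (rule sym_pow_subset)

text \<open>Inequality (ii) with denominators cleared: the \<open>(m + 1)\<close>-st power of a form
  of least degree in \<open>sym_pow r\<close> lies in the product ideal of (i) for
  \<open>t = r\<close>, all of whose terms have degree at least the left side.\<close>

lemma alpha_sym_pow_le: "r * (alpha (sym_pow m) + 1) \<le> (m + 1) * alpha (sym_pow r)"
proof -
  \<comment> \<open>A nonzero form in \<open>sym_pow r\<close>, so that the minimum defining
    \<open>alpha\<close> is attained.\<close>
  have "mon (\<lambda>_. r) \<in> sym_pow r" by (rule mon_mem_sym_pow) simp
  then have "\<exists>d. \<exists>F\<in>sym_pow r. F \<noteq> 0 \<and> form d F" using form_mon mon_nonzero by blast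
  then have "\<exists>F\<in>sym_pow r. F \<noteq> 0 \<and> form (alpha (sym_pow r)) F"
    unfolding alpha_def by (rule LeastI_ex)
  then obtain F where F: "F \<in> sym_pow r" "F \<noteq> 0" "form (alpha (sym_pow r)) F" by blast
  have "F ^ (m + 1) \<in> sym_pow (r * (m + 1))" using F(1) by (rule sym_pow_power)
  moreover have "sym_pow (r * (m + 1))
      \<subseteq> ideal_mult (ideal_pow irrelevant_ideal r) (ideal_pow (sym_pow m) r)"
    using sym_pow_subset_irrelevant[of 0 r m] by simp
  moreover have "\<dots> \<subseteq> order_ge (r * 1 + r * alpha (sym_pow m))"
    by (intro ideal_mult_subset_order_ge ideal_pow_subset_order_ge
        irrelevant_ideal_subset_order_ge sym_pow_subset_order_ge_alpha)
  ultimately have "F ^ (m + 1) \<in> order_ge (r * 1 + r * alpha (sym_pow m))" by blast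
  from form_le_of_order_ge[OF form_power[OF F(3)] _ this] show ?thesis
    using F(2) by (simp add: algebra_simps)
qed

end

section \<open>The points of intersection of lines in general position\<close>

text \<open>The lines serve as their own indices, and \<open>c\<close> chooses a coefficient vector
  for each.\<close>

context
  fixes \<L> :: "('k::field ^ 3) set set set" and c :: "('k ^ 3) set set \<Rightarrow> 'k ^ 3"
  assumes finite_lines: "finite \<L>" and two_lines: "card \<L> \<ge> 2"
    and c: "\<And>L. L \<in> \<L> \<Longrightarrow> c L \<noteq> 0" "\<And>L. L \<in> \<L> \<Longrightarrow> L = line_of (c L)"
    and no_three: "\<forall>L1\<in>\<L>. \<forall>L2\<in>\<L>. \<forall>L3\<in>\<L>.
           L1 \<noteq> L2 \<and> L1 \<noteq> L3 \<and> L2 \<noteq> L3 \<longrightarrow> L1 \<inter> L2 \<inter> L3 = {}"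
begin

lemma not_proportional:
  assumes "L \<in> \<L>" "L' \<in> \<L>" "L \<noteq> L'"
  shows "c L' \<noteq> k *s c L"
proof
  assume k: "c L' = k *s c L"
  then have "k \<noteq> 0" using c(1)[OF assms(2)] by auto
  then have "line_of (c L') = line_of (c L)" unfolding k by (rule line_of_scale)
  then show False using c(2) assms by metis
qed

lemma linear_star: "linear_star_configuration \<L> c"
proof
  fix i j k assume ijk: "i \<in> \<L>" "j \<in> \<L>" "k \<in> \<L>" "i \<noteq> j" "i \<noteq> k" "j \<noteq> k"
  \<comment> \<open>The point of \<open>v\<close> is on lines \<open>i\<close> and \<open>j\<close>,
    so general position keeps it off line \<open>k\<close>; this is the nonvanishing that
    \<open>cancels_linear_form\<close> asks for.\<close>
  obtain v where v: "v \<noteq> 0" "dot3 (c i) v = 0" "dot3 (c j) v = 0" using ex_common_zero by blast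
  have "proj_rel `` {v} \<in> line_of (c i) \<inter> line_of (c j)" using v by (simp add: mem_line_of)
  moreover have "i \<inter> j \<inter> k = {}" using no_three ijk by blast
  ultimately have "proj_rel `` {v} \<notin> line_of (c k)" using c(2) ijk by blast
  then have "dot3 (c k) v \<noteq> 0" using v(1) by (simp add: mem_line_of)
  with v show "cancels (linear_form (c i)) (linear_form (c j)) (linear_form (c k))"
    using c(1) not_proportional ijk by (intro cancels_linear_form) auto
next
  fix i j G assume "i \<in> \<L>" "j \<in> \<L>" "i \<noteq> j" "linear_form (c i) dvd linear_form (c j) * G"
  then show "linear_form (c i) dvd G"
    using linear_form_dvd_cancel[of "c i" "c j" G] c(1) not_proportional by blast
qed (use finite_lines two_lines c(1) in \<open>simp_all add: linear_form_eq_0_iff\<close>)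

text \<open>Both sides intersect powers of the same ideals: any two distinct lines have a common
  point, every point of the configuration arises in this way, and its ideal is generated by the two
  linear forms.\<close>

lemma symbolic_power_intersection_points:
  "symbolic_power (intersection_points \<L>) m
     = star_configuration.sym_pow \<L> (\<lambda>L. linear_form (c L)) m" (is "?l = ?r")
proof -
  interpret linear_star_configuration \<L> c by (rule linear_star)
  have pt: "point_ideal (proj_rel `` {v}) = ideal_gen {linear_form (c L), linear_form (c L')}"
    if "L \<in> \<L>" "L' \<in> \<L>" "L \<noteq> L'" "v \<noteq> 0" "dot3 (c L) v = 0" "dot3 (c L') v = 0" for L L' v
    using that c(1) not_proportional by (intro point_ideal_eq) auto
  show ?thesis
  proof
    show "?l \<subseteq> ?r"
      unfolding sym_pow_def
    proof (intro subsetI INT_I)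
      fix F L L' assume F: "F \<in> ?l" and L: "L \<in> \<L>" "L' \<in> \<L> - {L}"
      obtain v where v: "v \<noteq> 0" "dot3 (c L) v = 0" "dot3 (c L') v = 0" using ex_common_zero by blast
      then have "proj_rel `` {v} \<in> L \<inter> L'" using c(2) L by (metis DiffD1 IntI mem_line_of)
      then have "proj_rel `` {v} \<in> intersection_points \<L>"
        using L unfolding intersection_points_def by blast
      then have "F \<in> ideal_pow (point_ideal (proj_rel `` {v})) m"
        using F unfolding symbolic_power_def by blast
      moreover have "point_ideal (proj_rel `` {v}) = ideal_gen {linear_form (c L), linear_form (c L')}"
        using L v by (intro pt) auto
      ultimately show "F \<in> ideal_pow (ideal_gen {linear_form (c L), linear_form (c L')}) m"
        by (simp only:)
    qed
    show "?r \<subseteq> ?l"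
      unfolding symbolic_power_def
    proof (intro subsetI INT_I)
      fix F P assume F: "F \<in> ?r" and "P \<in> intersection_points \<L>"
      then obtain L L' where L: "L \<in> \<L>" "L' \<in> \<L>" "L \<noteq> L'" "P \<in> L" "P \<in> L'"
        unfolding intersection_points_def by blast
      then have "P \<in> line_of (c L)" using c(2) by blast
      then obtain v where v: "P = proj_rel `` {v}" "v \<noteq> 0" "dot3 (c L) v = 0"
        unfolding line_of_def by blast
      have "P \<in> line_of (c L')" using c(2) L by blast
      then have "dot3 (c L') v = 0" using v mem_line_of by blast
      then have "point_ideal P = ideal_gen {linear_form (c L), linear_form (c L')}"
        using pt L v by blast
      then show "F \<in> ideal_pow (point_ideal P) m"
        using F L unfolding sym_pow_def by auto
    qed
  qed
qed

end

theorem mainTheorem9: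
  fixes \<L> :: "('k::{alg_closed_field, field_char_0} ^ 3) set set set"
    and Z :: "('k ^ 3) set set"
    and M :: "'k poly3 set"
    and s m t r :: nat
  assumes "s \<ge> 2"
    and "finite \<L>" and "card \<L> = s"
    and "\<forall>L\<in>\<L>. proj_line L"
    and "\<forall>L1\<in>\<L>. \<forall>L2\<in>\<L>. \<forall>L3\<in>\<L>.
           L1 \<noteq> L2 \<and> L1 \<noteq> L3 \<and> L2 \<noteq> L3 \<longrightarrow> L1 \<inter> L2 \<inter> L3 = {}"
    and "Z = intersection_points \<L>"
    and "M = irrelevant_ideal"
    and "m \<ge> 1" and "t \<ge> 1" and "r \<ge> 1"
  shows "symbolic_power Z (t * (m + 1))
           \<subseteq> ideal_mult (ideal_pow M t) (ideal_pow (symbolic_power Z m) t) \<and>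
         (real (alpha (symbolic_power Z m)) + 1) / (real m + 1)
           \<le> real (alpha (symbolic_power Z r)) / real r \<and>
         symbolic_power Z (t * (m + 1) - 1)
           \<subseteq> ideal_mult (ideal_pow M (t - 1)) (ideal_pow (symbolic_power Z m) t) \<and>
         symbolic_power Z (t * (m + 1) - 1) \<subseteq> ideal_pow (symbolic_power Z m) t"
proof -
  have "\<forall>L\<in>\<L>. \<exists>a. a \<noteq> 0 \<and> L = line_of a" using assms(4) proj_line_imp_line_of by blast
  then obtain c where c: "\<And>L. L \<in> \<L> \<Longrightarrow> c L \<noteq> 0" "\<And>L. L \<in> \<L> \<Longrightarrow> L = line_of (c L)"
    by metis
  have card: "card \<L> \<ge> 2" using assms by simp
  interpret linear_star_configuration \<L> c
    by (rule linear_star[OF assms(2) card c assms(5)])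
  have Z: "symbolic_power Z n = sym_pow n" for n
    unfolding assms(6) by (rule symbolic_power_intersection_points[OF assms(2) card c assms(5)])
  have i: "sym_pow (t * (m + 1)) \<subseteq> ideal_mult (ideal_pow M t) (ideal_pow (sym_pow m) t)"
    using sym_pow_subset_irrelevant[of 0 t m] by (simp add: assms(7))
  have "real r * (real (alpha (sym_pow m)) + 1) \<le> (real m + 1) * real (alpha (sym_pow r))"
    using alpha_sym_pow_le[of r m, folded of_nat_le_iff[where 'a = real]]
    by (simp add: algebra_simps)
  then have ii: "(real (alpha (sym_pow m)) + 1) / (real m + 1) \<le> real (alpha (sym_pow r)) / real r"
    using assms(10) by (simp add: field_simps)
  \<comment> \<open>With \<open>t = Suc u\<close>, the exponent \<open>t * (m + 1) - 1\<close>
    equals \<open>u * (m + 1) + m\<close>, which is the case \<open>e = 1\<close> with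
    \<open>u\<close> in place of \<open>t\<close>.\<close>
  obtain u where u: "t = Suc u" using assms(9) by (cases t) auto
  have iii: "sym_pow (t * (m + 1) - 1)
      \<subseteq> ideal_mult (ideal_pow M (t - 1)) (ideal_pow (sym_pow m) t)"
    using sym_pow_subset_irrelevant[of 1 u m] by (simp add: assms(7) u ac_simps)
  moreover have "\<dots> \<subseteq> ideal_pow (sym_pow m) t"
    by (rule ideal_mult_subset_right) simp
  ultimately show ?thesis unfolding Z using i ii by blast
qed

end
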